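(* Let $T_1,T_2\subset\mathsf{Ein}^3$ be a pair of Einstein tori. Then $T_1\cap T_2$ is non-contractible as a subset of $T_1$, and non-contractible as a subset of $T_2$.
   Context: Let $W$ be a $5$-dimensional real vector space with a symmetric bilinear form $\cdot$ of signature $(3,2)$ (three positive, two negative directions). For a linear subspace $U\subset W$ let $\mathcal N(U)=\{v\in U: v\cdot v=0\}$, and let $\mathbb P(\mathcal N(U))$ be the set of points $[v]$ of $\mathbb P(W)$ with $0\ne v\in\mathcal N(U)$. The Einstein universe is $\mathsf{Ein}^3=\mathbb P(\mathcal N(W))$. An Einstein torus is $\mathbb P(\mathcal N(s^\perp))$ where $s\in W$ satisfies $s\cdot s>0$; it is homeomorphic to a $2$-torus $S^1\times S^1$. A subset $A$ of a space $X$ is non-contractible as a subset of $X$ if the inclusion $A\hookrightarrow X$ is not homotopic to a constant map. *)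

theory Defs
  imports "HOL-Analysis.Analysis"
begin

definition symmetric_bilinear_form :: "('a::real_vector \<Rightarrow> 'a \<Rightarrow> real) \<Rightarrow> bool" where
  "symmetric_bilinear_form B \<longleftrightarrow> bilinear B \<and> (\<forall>x y. B x y = B y x)"

text \<open>The numbers of positive and negative vectors in an orthogonal basis do not depend on the
  basis (Sylvester's law of inertia). The form is nondegenerate when \<open>p + q\<close> is the dimension.\<close>

definition has_signature :: "('a::real_vector \<Rightarrow> 'a \<Rightarrow> real) \<Rightarrow> nat \<Rightarrow> nat \<Rightarrow> bool" where
  "has_signature B p q \<longleftrightarrow>
     (\<exists>E. independent E \<and> span E = UNIV \<and> finite E \<and> pairwise (\<lambda>x y. B x y = 0) E \<and>
          card {e \<in> E. B e e > 0} = p \<and> card {e \<in> E. B e e < 0} = q)"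

text \<open>The point \<open>[v]\<close> of projective space is the line \<open>span {v}\<close>.\<close>

definition projectivization :: "'a::real_vector set \<Rightarrow> 'a set set" where
  "projectivization S = (\<lambda>v. span {v}) ` (S - {0})"

definition projective_topology :: "'a::euclidean_space set topology" where
  "projective_topology =
     topology (\<lambda>U. U \<subseteq> projectivization UNIV \<and> open {v. v \<noteq> 0 \<and> span {v} \<in> U})"

lemma openin_projective_topology:
  "openin projective_topology U \<longleftrightarrow>
     U \<subseteq> projectivization UNIV \<and> open {v::'a::euclidean_space. v \<noteq> 0 \<and> span {v} \<in> U}"
proof -
  let ?L = "\<lambda>U. U \<subseteq> projectivization UNIV \<and> open {v::'a. v \<noteq> 0 \<and> span {v} \<in> U}"
  have "istopology ?L"
    unfolding istopology_def
  proof (intro conjI allI impI)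
    fix S T assume "?L S" "?L T"
    moreover have "{v::'a. v \<noteq> 0 \<and> span {v} \<in> S \<inter> T} =
        {v. v \<noteq> 0 \<and> span {v} \<in> S} \<inter> {v. v \<noteq> 0 \<and> span {v} \<in> T}"
      by auto
    ultimately show "S \<inter> T \<subseteq> projectivization UNIV"
      and "open {v::'a. v \<noteq> 0 \<and> span {v} \<in> S \<inter> T}"
      by auto
  next
    fix K assume K: "\<forall>S\<in>K. ?L S"
    have "{v::'a. v \<noteq> 0 \<and> span {v} \<in> \<Union>K} = (\<Union>S\<in>K. {v. v \<noteq> 0 \<and> span {v} \<in> S})"
      by auto
    then show "\<Union>K \<subseteq> projectivization UNIV"
      and "open {v::'a. v \<noteq> 0 \<and> span {v} \<in> \<Union>K}"
      using K by auto
  qed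
  then show ?thesis
    by (simp add: projective_topology_def topology_inverse')
qed

lemma topspace_projective_topology:
  "topspace (projective_topology :: 'a::euclidean_space set topology) = projectivization UNIV"
proof -
  have "{v::'a. v \<noteq> 0 \<and> span {v} \<in> projectivization UNIV} = - {0}"
    by (auto simp: projectivization_def)
  then have "openin projective_topology (projectivization (UNIV :: 'a set))"
    by (simp add: openin_projective_topology open_Compl)
  then show ?thesis
    by (meson openin_projective_topology openin_subset openin_topspace subset_antisym)
qed

lemma quotient_map_projective_topology:
  "quotient_map (top_of_set (- {0})) projective_topology (\<lambda>v::'a::euclidean_space. span {v})"
proof -
  have "openin (top_of_set (- {0})) {v. v \<noteq> 0 \<and> span {v} \<in> U} \<longleftrightarrow>
        open {v::'a. v \<noteq> 0 \<and> span {v} \<in> U}" for U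
  proof -
    have "{v::'a. v \<noteq> 0 \<and> span {v} \<in> U} \<subseteq> - {0}"
      by auto
    moreover have "open (- {0::'a})"
      by (simp add: open_Compl)
    ultimately show ?thesis
      by (simp add: openin_open_eq)
  qed
  then show ?thesis
    unfolding quotient_map_def topspace_projective_topology
    by (simp add: openin_projective_topology projectivization_def Compl_eq_Diff_UNIV)
qed

definition null_vectors :: "('a \<Rightarrow> 'a \<Rightarrow> real) \<Rightarrow> 'a set \<Rightarrow> 'a set" where
  "null_vectors B U = {v \<in> U. B v v = 0}"

definition perp :: "('a \<Rightarrow> 'a \<Rightarrow> real) \<Rightarrow> 'a \<Rightarrow> 'a set" where
  "perp B s = {v. B s v = 0}"

definition einstein_universe :: "('a::real_vector \<Rightarrow> 'a \<Rightarrow> real) \<Rightarrow> 'a set set" where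
  "einstein_universe B = projectivization (null_vectors B UNIV)"

definition einstein_topology :: "('a::euclidean_space \<Rightarrow> 'a \<Rightarrow> real) \<Rightarrow> 'a set topology" where
  "einstein_topology B = subtopology projective_topology (einstein_universe B)"

definition einstein_torus :: "('a::real_vector \<Rightarrow> 'a \<Rightarrow> real) \<Rightarrow> 'a set set \<Rightarrow> bool" where
  "einstein_torus B T \<longleftrightarrow> (\<exists>s. B s s > 0 \<and> T = projectivization (null_vectors B (perp B s)))"

lemma einstein_torus_subset: "einstein_torus B T \<Longrightarrow> T \<subseteq> einstein_universe B"
  by (auto simp: einstein_torus_def einstein_universe_def null_vectors_def projectivization_def)

definition noncontractible_in :: "'b topology \<Rightarrow> 'b set \<Rightarrow> bool" where
  "noncontractible_in X A \<longleftrightarrow>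
     A \<subseteq> topspace X \<and>
     \<not> (\<exists>c \<in> topspace X. homotopic_with (\<lambda>_. True) (subtopology X A) X (\<lambda>x. x) (\<lambda>_. c))"

end

theory Submission
  imports Defs
begin

text \<open>By Sylvester's law of inertia, \<open>perp B s\<close> has signature \<open>(2, 2)\<close>, so it has
  coordinates \<open>(u, w)\<close> in \<open>\<complex> \<times> \<complex>\<close> in which \<open>B v v = (norm u)\<^sup>2 - (norm w)\<^sup>2\<close>. The direction of
  \<open>u * w\<close> depends only on \<open>[v]\<close> and maps the torus to the unit circle. The other torus cuts out
  a real hyperplane \<open>Re (a * u + b * w) = 0\<close> (or imposes nothing), and on it there is a null circle
  \<open>u = z * k z\<close>, \<open>w = z * cnj (k z)\<close> with \<open>z\<close> on the unit circle. The composition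
  circle \<open>\<rightarrow>\<close> intersection \<open>\<rightarrow>\<close> torus \<open>\<rightarrow>\<close> circle is \<open>z \<mapsto> z\<^sup>2\<close>, which is not nullhomotopic. This
  argument needs no case distinction on the relative position of the two tori.\<close>

section \<open>Orthogonal bases and Sylvester's law of inertia\<close>

context
  fixes B :: "'a::euclidean_space \<Rightarrow> 'a \<Rightarrow> real"
  assumes form: "symmetric_bilinear_form B"
begin

lemma form_commute: "B x y = B y x"
  using form by (simp add: symmetric_bilinear_form_def)

lemma linear_form_right: "linear (B x)"
  using form by (simp add: symmetric_bilinear_form_def bilinear_def)

lemma subspace_perp: "subspace (perp B s)"
  using linear_subspace_kernel[OF linear_form_right] by (simp add: perp_def)

lemmas form_right_simps =
  linear_add[OF linear_form_right] linear_diff[OF linear_form_right]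
  linear_scale[OF linear_form_right] linear_0[OF linear_form_right]

lemma form_left_simps:
  "B (x + y) z = B x z + B y z" "B (x - y) z = B x z - B y z"
  "B (c *\<^sub>R x) z = c * B x z" "B 0 z = 0"
  using form_right_simps[of z] by (simp_all add: form_commute[of _ z])

lemma perp_decomposition:
  assumes "B v v \<noteq> 0"
  shows "x - (B v x / B v v) *\<^sub>R v \<in> perp B v"
  using assms by (simp add: perp_def form_right_simps)

text \<open>Subtracting the \<open>B\<close>-projection along the non-null vector \<open>v\<close>
  splits \<open>V\<close> into the line of \<open>v\<close> and \<open>V \<inter> perp B v\<close>.
  This serves the inductive construction of orthogonal bases and later the extension of a basis of
  \<open>perp B s\<close> by \<open>s\<close>.\<close>

lemma insert_perp_basis:
  assumes V: "subspace V" "v \<in> V" "B v v \<noteq> 0"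
    and E: "independent E" "span E = V \<inter> perp B v" "pairwise (\<lambda>x y. B x y = 0) E"
  shows "independent (insert v E) \<and> span (insert v E) = V \<and>
         pairwise (\<lambda>x y. B x y = 0) (insert v E)"
proof (intro conjI)
  have "v \<notin> span E"
    using V E by (auto simp: perp_def)
  then show "independent (insert v E)"
    using E by (simp add: independent_insertI)
  show "span (insert v E) = V"
  proof
    show "span (insert v E) \<subseteq> V"
      using V E span_superset[of E] by (intro span_minimal) auto
  next
    show "V \<subseteq> span (insert v E)"
    proof
      fix x assume "x \<in> V"
      then have "x - (B v x / B v v) *\<^sub>R v \<in> span E"
        using V E perp_decomposition by (simp add: subspace_diff subspace_scale)
      then show "x \<in> span (insert v E)"
        by (auto simp: span_insert)
    qed
  qed
  have "B v e = 0" "B e v = 0" if "e \<in> E" for e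
    using span_base[OF that] E(2) form_commute by (auto simp: perp_def)
  then show "pairwise (\<lambda>x y. B x y = 0) (insert v E)"
    using E(3) by (simp add: pairwise_insert)
qed

text \<open>Induction on the dimension, splitting off a non-null vector. If there is none, the form
  vanishes identically on \<open>V\<close>, so any basis is orthogonal.\<close>

lemma orthogonal_basis_exists:
  assumes "subspace V"
  obtains E where "independent E" "span E = V" "pairwise (\<lambda>x y. B x y = 0) E"
proof -
  have "\<exists>E. independent E \<and> span E = V \<and> pairwise (\<lambda>x y. B x y = 0) E"
    using assms
  proof (induction "dim V" arbitrary: V rule: less_induct)
    case less
    show ?case
    proof (cases "\<exists>v\<in>V. B v v \<noteq> 0")
      case True
      then obtain v where v: "v \<in> V" "B v v \<noteq> 0" by auto
      have sub: "subspace (V \<inter> perp B v)"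
        by (simp add: less.prems subspace_inter subspace_perp)
      have "V \<inter> perp B v \<subset> V"
        using v by (auto simp: perp_def)
      then have "dim (V \<inter> perp B v) < dim V"
        using sub less.prems by (metis dim_psubset span_eq_iff)
      then obtain E where "independent E" "span E = V \<inter> perp B v"
        "pairwise (\<lambda>x y. B x y = 0) E"
        using less.hyps sub by blast
      then show ?thesis
        using insert_perp_basis less.prems v by blast
    next
      case False
      \<comment> \<open>Polarization: a symmetric form with zero quadratic form is zero.\<close>
      have *: "B x y = 0" if "x \<in> V" "y \<in> V" for x y
      proof -
        have "B (x + y) (x + y) = 0" "B x x = 0" "B y y = 0"
          using False that less.prems by (auto simp: subspace_add)
        then show ?thesis
          by (simp add: form_left_simps form_right_simps form_commute[of y x])
      qed
      obtain E where E: "E \<subseteq> V" "independent E" "V \<subseteq> span E"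
        using basis_exists[of V] by metis
      moreover have "span E = V"
        using E less.prems by (simp add: span_minimal subset_antisym)
      moreover have "pairwise (\<lambda>x y. B x y = 0) E"
        using * E(1) by (auto simp: pairwise_def)
      ultimately show ?thesis
        by blast
    qed
  qed
  then show ?thesis
    using that by blast
qed

lemma form_orthogonal_sum:
  assumes "finite E" "pairwise (\<lambda>x y. B x y = 0) E"
  shows "B (\<Sum>e\<in>E. a e *\<^sub>R e) (\<Sum>e\<in>E. a e *\<^sub>R e) = (\<Sum>e\<in>E. (a e)\<^sup>2 * B e e)"
proof -
  have "B (\<Sum>e\<in>E. a e *\<^sub>R e) (a d *\<^sub>R d) = (a d)\<^sup>2 * B d d" if "d \<in> E" for d
  proof -
    have "B (\<Sum>e\<in>E. a e *\<^sub>R e) (a d *\<^sub>R d) = a d * B d (\<Sum>e\<in>E. a e *\<^sub>R e)"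
      by (subst form_commute) (simp add: form_left_simps)
    also have "\<dots> = (\<Sum>e\<in>E. a d * (a e * B d e))"
      by (simp add: linear_sum[OF linear_form_right] form_right_simps sum_distrib_left)
    also have "\<dots> = (\<Sum>e\<in>E. if e = d then (a d)\<^sup>2 * B d d else 0)"
      using assms(2) that by (intro sum.cong) (auto simp: pairwise_def power2_eq_square)
    finally show ?thesis
      using assms(1) that by simp
  qed
  then show ?thesis
    by (subst linear_sum[OF linear_form_right]) simp
qed

text \<open>The span of the positive vectors of \<open>E\<close> meets the span of the nonpositive vectors of \<open>F\<close>
  only in \<open>0\<close>.\<close>

lemma card_positive_le:
  assumes E: "independent E" "pairwise (\<lambda>x y. B x y = 0) E"
    and F: "independent F" "span F = UNIV" "pairwise (\<lambda>x y. B x y = 0) F"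
  shows "card {e \<in> E. B e e > 0} \<le> card {e \<in> F. B e e > 0}"
proof -
  define P where "P = {e \<in> E. B e e > 0}"
  define N where "N = {e \<in> F. B e e \<le> 0}"
  have ind: "independent P" "independent N" and fin: "finite P" "finite N" "finite F"
    using E F independent_mono[of E P] independent_mono[of F N]
    by (auto simp: P_def N_def finiteI_independent)
  have orth: "pairwise (\<lambda>x y. B x y = 0) P" "pairwise (\<lambda>x y. B x y = 0) N"
    using E F by (auto simp: P_def N_def pairwise_def)
  have "span P \<inter> span N \<subseteq> {0}"
  proof clarify
    fix x assume x: "x \<in> span P" "x \<in> span N"
    obtain a where a: "x = (\<Sum>e\<in>P. a e *\<^sub>R e)"
      using x(1) fin by (auto simp: span_finite)
    obtain b where b: "x = (\<Sum>e\<in>N. b e *\<^sub>R e)"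
      using x(2) fin by (auto simp: span_finite)
    \<comment> \<open>The expansion of \<open>x\<close> in \<open>N\<close> gives
      \<open>B x x \<le> 0\<close>, while its expansion in \<open>P\<close> makes
      \<open>B x x\<close> a sum of nonnegative terms, so every coefficient \<open>a e\<close> is
      zero.\<close>
    have "B x x \<le> 0"
      unfolding b form_orthogonal_sum[OF fin(2) orth(2)]
      by (intro sum_nonpos) (auto simp: N_def mult_nonneg_nonpos)
    then have le: "(\<Sum>e\<in>P. (a e)\<^sup>2 * B e e) \<le> 0"
      by (simp add: a form_orthogonal_sum[OF fin(1) orth(1)])
    have nonneg: "\<forall>e\<in>P. (a e)\<^sup>2 * B e e \<ge> 0"
      by (auto simp: P_def)
    then have "(\<Sum>e\<in>P. (a e)\<^sup>2 * B e e) = 0"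
      using le by (meson antisym sum_nonneg)
    then have "\<forall>e\<in>P. (a e)\<^sup>2 * B e e = 0"
      using nonneg fin(1) by (subst (asm) sum_nonneg_eq_0_iff) auto
    then show "x = 0"
      unfolding a by (intro sum.neutral) (auto simp: P_def)
  qed
  then have "dim (span P \<inter> span N) = 0"
    by simp
  then have "dim (span P) + dim (span N) \<le> DIM('a)"
    using dim_sums_Int[OF subspace_span subspace_span, of P N]
      dim_subset_UNIV[of "{x + y |x y. x \<in> span P \<and> y \<in> span N}"] by linarith
  \<comment> \<open>\<open>N\<close> is the complement in the full basis \<open>F\<close> of its
    positive vectors, so this bounds \<open>card P\<close> by their number.\<close>
  then have "card P + card N \<le> DIM('a)"
    using ind by (simp add: dim_eq_card_independent)
  moreover have "card F = DIM('a)"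
    using F by (metis dim_UNIV dim_span dim_eq_card_independent)
  moreover have "card ({e \<in> F. B e e > 0} \<union> N) = card {e \<in> F. B e e > 0} + card N"
    using fin by (intro card_Un_disjoint) (auto simp: N_def)
  moreover have "{e \<in> F. B e e > 0} \<union> N = F"
    by (auto simp: N_def)
  ultimately show ?thesis
    by (simp add: P_def)
qed

end

lemma symmetric_bilinear_form_uminus:
  "symmetric_bilinear_form B \<Longrightarrow> symmetric_bilinear_form (\<lambda>x y. - B x y)"
  by (auto simp: symmetric_bilinear_form_def bilinear_def linear_compose_neg)

text \<open>\<open>has_signature\<close> only provides one basis with the right counts. Comparing
  two bases in both directions gives the positive count; the same comparison for \<open>- B\<close>
  gives the negative one.\<close>

lemma sylvester_inertia:
  fixes B :: "'a::euclidean_space \<Rightarrow> 'a \<Rightarrow> real"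
  assumes "symmetric_bilinear_form B" "has_signature B p q"
    and F: "independent F" "span F = UNIV" "pairwise (\<lambda>x y. B x y = 0) F"
  shows "card {e \<in> F. B e e > 0} = p" "card {e \<in> F. B e e < 0} = q"
proof -
  obtain E where E: "independent E" "span E = UNIV" "pairwise (\<lambda>x y. B x y = 0) E"
    "card {e \<in> E. B e e > 0} = p" "card {e \<in> E. B e e < 0} = q"
    using assms(2) unfolding has_signature_def by blast
  show "card {e \<in> F. B e e > 0} = p"
    using card_positive_le[OF assms(1) E(1,3) F] card_positive_le[OF assms(1) F(1,3) E(1-3)] E(4)
    by simp
  have E': "pairwise (\<lambda>x y. - B x y = 0) E" and F': "pairwise (\<lambda>x y. - B x y = 0) F"
    using E F by simp_all
  note neg = symmetric_bilinear_form_uminus[OF assms(1)]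
  show "card {e \<in> F. B e e < 0} = q"
    using card_positive_le[OF neg E(1) E' F(1,2) F']
      card_positive_le[OF neg F(1) F' E(1,2) E'] E(5) by simp
qed

section \<open>Complex coordinates on the orthogonal complement of a positive vector\<close>

lemma perp_signature:
  fixes B :: "'a::euclidean_space \<Rightarrow> 'a \<Rightarrow> real"
  assumes form: "symmetric_bilinear_form B" and sig: "has_signature B (Suc p) q"
    and dim: "DIM('a) = Suc (p + q)" and s: "B s s > 0"
  obtains P N where "card P = p" "card N = q" "finite P" "finite N"
    "span (P \<union> N) = perp B s" "pairwise (\<lambda>x y. B x y = 0) (P \<union> N)"
    "\<And>e. e \<in> P \<Longrightarrow> B e e > 0" "\<And>e. e \<in> N \<Longrightarrow> B e e < 0"
proof -
  obtain E where E: "independent E" "span E = perp B s" "pairwise (\<lambda>x y. B x y = 0) E"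
    using orthogonal_basis_exists[OF form subspace_perp[OF form]] by blast
  have F: "independent (insert s E)" "span (insert s E) = UNIV"
    "pairwise (\<lambda>x y. B x y = 0) (insert s E)"
    using insert_perp_basis[OF form subspace_UNIV _ _ E(1) _ E(3)] s E(2) by auto
  define P where "P = {e \<in> E. B e e > 0}"
  define N where "N = {e \<in> E. B e e < 0}"
  have "finite E"
    using E(1) finiteI_independent by blast
  then have fin: "finite P" "finite N"
    by (auto simp: P_def N_def)
  have "s \<notin> E"
    using s E(2) span_base[of s E] by (auto simp: perp_def)
  \<comment> \<open>In the full orthogonal basis \<open>insert s E\<close> the vector
    \<open>s\<close> accounts for exactly one of the \<open>Suc p\<close> positive ones.\<close>
  have "{e \<in> insert s E. B e e > 0} = insert s P" "{e \<in> insert s E. B e e < 0} = N"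
    using s by (auto simp: P_def N_def)
  then have card: "card P = p" "card N = q"
    using sylvester_inertia[OF form sig F] \<open>s \<notin> E\<close> fin by (auto simp: P_def)
  \<comment> \<open>The dimension count leaves no room in \<open>E\<close> for vectors with
    \<open>B e e = 0\<close>.\<close>
  have "card (insert s E) = Suc (p + q)"
    using F dim by (metis dim_UNIV dim_span dim_eq_card_independent)
  then have "card E = p + q"
    using \<open>s \<notin> E\<close> \<open>finite E\<close> by simp
  moreover have "card (P \<union> N) = p + q"
    using card fin by (subst card_Un_disjoint) (auto simp: P_def N_def)
  ultimately have "P \<union> N = E"
    using \<open>finite E\<close> by (intro card_subset_eq) (auto simp: P_def N_def)
  then have "span (P \<union> N) = perp B s" "pairwise (\<lambda>x y. B x y = 0) (P \<union> N)"
    using E by simp_all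
  moreover have "B e e > 0" if "e \<in> P" for e
    using that by (simp add: P_def)
  moreover have "B e e < 0" if "e \<in> N" for e
    using that by (simp add: N_def)
  ultimately show ?thesis
    using that card fin by blast
qed

text \<open>The complement has signature (2, 2); its two positive basis vectors become the real and
  imaginary axes of \<open>u\<close>, its two negative ones those of \<open>w\<close>.
  \<open>U\<close> and \<open>W\<close> are linear on the whole space but invert
  \<open>\<Phi>\<close> only on \<open>perp B s\<close>.\<close>

lemma perp_complex_coordinates:
  fixes B :: "'a::euclidean_space \<Rightarrow> 'a \<Rightarrow> real"
  assumes form: "symmetric_bilinear_form B" and sig: "has_signature B 3 2"
    and dim: "DIM('a) = 5" and s: "B s s > 0"
  obtains \<Phi> :: "complex \<times> complex \<Rightarrow> 'a" and U W :: "'a \<Rightarrow> complex"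
  where "linear \<Phi>" "linear U" "linear W" "\<And>p. \<Phi> p \<in> perp B s"
    "\<And>u w. U (\<Phi> (u, w)) = u" "\<And>u w. W (\<Phi> (u, w)) = w"
    "\<And>v. v \<in> perp B s \<Longrightarrow> \<Phi> (U v, W v) = v"
    "\<And>u w. B (\<Phi> (u, w)) (\<Phi> (u, w)) = (norm u)\<^sup>2 - (norm w)\<^sup>2"
proof -
  note form_simps = form_right_simps[OF form] form_left_simps[OF form]
  obtain P N where PN: "card P = 2" "card N = 2" "span (P \<union> N) = perp B s"
    "pairwise (\<lambda>x y. B x y = 0) (P \<union> N)"
    and pos: "\<And>e. e \<in> P \<Longrightarrow> B e e > 0" and neg: "\<And>e. e \<in> N \<Longrightarrow> B e e < 0"
    by (rule perp_signature[of B 2 2 s]) (use assms in \<open>auto simp: numeral_3_eq_3\<close>)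
  obtain p1 p2 n1 n2 where P: "P = {p1, p2}" "p1 \<noteq> p2" and N: "N = {n1, n2}" "n1 \<noteq> n2"
    using PN(1,2) by (auto simp: card_2_iff)
  have signs: "B p1 p1 > 0" "B p2 p2 > 0" "B n1 n1 < 0" "B n2 n2 < 0"
    using pos neg P N by auto
  then have "p1 \<noteq> n1" "p1 \<noteq> n2" "p2 \<noteq> n1" "p2 \<noteq> n2"
    by auto
  then have orth: "B p1 p2 = 0" "B p1 n1 = 0" "B p1 n2 = 0" "B p2 n1 = 0" "B p2 n2 = 0"
    "B n1 n2 = 0" "B p2 p1 = 0" "B n1 p1 = 0" "B n2 p1 = 0" "B n1 p2 = 0" "B n2 p2 = 0" "B n2 n1 = 0"
    using PN(4) P N by (auto simp: pairwise_def)
  \<comment> \<open>Scaling by \<open>l\<close> normalizes the values of the quadratic form to 1 and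
    -1.\<close>
  define l where "l v = 1 / sqrt \<bar>B v v\<bar>" for v
  have l: "l p1 * (l p1 * B p1 p1) = 1" "l p2 * (l p2 * B p2 p2) = 1"
    "l n1 * (l n1 * B n1 n1) = -1" "l n2 * (l n2 * B n2 n2) = -1"
    using signs by (auto simp: l_def)
  have l0: "l p1 \<noteq> 0" "l p2 \<noteq> 0" "l n1 \<noteq> 0" "l n2 \<noteq> 0"
    using l by auto
  define e1 e2 f1 f2
    where ef: "e1 = l p1 *\<^sub>R p1" "e2 = l p2 *\<^sub>R p2" "f1 = l n1 *\<^sub>R n1" "f2 = l n2 *\<^sub>R n2"
  have B: "B e1 e1 = 1" "B e2 e2 = 1" "B f1 f1 = -1" "B f2 f2 = -1"
    "B e1 e2 = 0" "B e1 f1 = 0" "B e1 f2 = 0" "B e2 f1 = 0" "B e2 f2 = 0" "B f1 f2 = 0"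
    "B e2 e1 = 0" "B f1 e1 = 0" "B f2 e1 = 0" "B f1 e2 = 0" "B f2 e2 = 0" "B f2 f1 = 0"
    using l orth by (simp_all add: ef form_simps)
  define \<Phi> where "\<Phi> = (\<lambda>p. Re (fst p) *\<^sub>R e1 + Im (fst p) *\<^sub>R e2 + Re (snd p) *\<^sub>R f1 + Im (snd p) *\<^sub>R f2)"
  define U where "U v = Complex (B e1 v) (B e2 v)" for v
  \<comment> \<open>Pairing with a basis vector reads off its coordinate; the signs compensate for
    \<open>B f1 f1 = B f2 f2 = -1\<close>.\<close>
  define W where "W v = Complex (- B f1 v) (- B f2 v)" for v
  have lin: "linear \<Phi>" "linear U" "linear W"
    by (auto simp: \<Phi>_def U_def W_def linear_iff form_simps algebra_simps complex_eq_iff)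
  have UW: "U (\<Phi> (u, w)) = u" "W (\<Phi> (u, w)) = w" for u w
    by (simp_all add: \<Phi>_def U_def W_def form_simps B)
  have "{p1, p2, n1, n2} \<subseteq> perp B s"
    using span_superset[of "P \<union> N"] PN(3) P N by auto
  then have perp: "\<Phi> p \<in> perp B s" for p
    by (simp add: \<Phi>_def ef subspace_add subspace_scale subspace_perp[OF form])
  have "\<Phi> (of_real (1 / l p1), 0) = p1" "\<Phi> (\<i> * of_real (1 / l p2), 0) = p2"
    "\<Phi> (0, of_real (1 / l n1)) = n1" "\<Phi> (0, \<i> * of_real (1 / l n2)) = n2"
    using l0 by (simp_all add: \<Phi>_def ef)
  then have "P \<union> N \<subseteq> range \<Phi>"
    unfolding P N by (auto intro!: range_eqI[OF sym])
  then have range: "perp B s \<subseteq> range \<Phi>"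
    using PN(3) lin by (metis linear_subspace_image span_minimal subspace_UNIV)
  have "\<Phi> (U v, W v) = v" if "v \<in> perp B s" for v
  proof -
    obtain p where "v = \<Phi> p"
      using \<open>v \<in> perp B s\<close> range by blast
    then show ?thesis
      using UW by (cases p) simp
  qed
  moreover have "B (\<Phi> (u, w)) (\<Phi> (u, w)) = (norm u)\<^sup>2 - (norm w)\<^sup>2" for u w
    by (simp add: \<Phi>_def form_simps B cmod_power2) (simp add: power2_eq_square)
  ultimately show ?thesis
    using that lin perp UW by blast
qed

section \<open>Null circles in hyperplanes, and the squaring map\<close>

lemma real_linear_complex_pair:
  fixes h :: "complex \<times> complex \<Rightarrow> real"
  assumes "linear h"
  obtains a b where "\<And>u w. h (u, w) = Re (a * u + b * w)"
proof -
  have "h (u, w) = Re (Complex (h (1, 0)) (- h (\<i>, 0)) * u + Complex (h (0, 1)) (- h (0, \<i>)) * w)"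
    for u w
  proof -
    have "(u, w) = Re u *\<^sub>R (1, 0) + Im u *\<^sub>R (\<i>, 0) + Re w *\<^sub>R (0, 1) + Im w *\<^sub>R (0, \<i>)"
      by (simp add: complex_eq_iff)
    then have "h (u, w) = Re u * h (1, 0) + Im u * h (\<i>, 0) + Re w * h (0, 1) + Im w * h (0, \<i>)"
      using assms by (simp only: linear_add linear_scale real_scaleR_def)
    then show ?thesis
      by (simp add: algebra_simps)
  qed
  then show ?thesis
    using that by blast
qed

text \<open>With \<open>u = z * k\<close> and \<open>w = z * cnj k\<close>, the equation \<open>Re (a * u + b * w) = 0\<close> reads
  \<open>Re ((a * z + cnj (b * z)) * k) = 0\<close>. The coefficient of \<open>k\<close> vanishes for some \<open>z\<close> only if
  \<open>norm a = norm b\<close>, and then a constant \<open>k\<close> will do.\<close>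

lemma hyperplane_circle_solution:
  fixes a b :: complex
  obtains k where "continuous_on (sphere 0 1) k" "\<And>z. z \<in> sphere 0 1 \<Longrightarrow> k z \<noteq> 0"
    "\<And>z. z \<in> sphere 0 1 \<Longrightarrow> Re (a * (z * k z) + b * (z * cnj (k z))) = 0"
proof (cases "norm a = norm b")
  case False
  define c where "c z = a * z + cnj (b * z)" for z
  have nz: "c z \<noteq> 0" if "z \<in> sphere 0 1" for z
  proof
    assume "c z = 0"
    then have "norm (a * z) = norm (cnj (b * z))"
      unfolding c_def by (metis add_eq_0_iff norm_minus_cancel)
    then show False
      using False that by (simp add: norm_mult)
  qed
  show ?thesis
  \<comment> \<open>With this \<open>k\<close>, the product \<open>c z * k z\<close> is
    \<open>\<i>\<close> times \<open>(norm (c z))\<^sup>2\<close>, hence purely imaginary.\<close>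
  proof (rule that[of "\<lambda>z. \<i> * cnj (c z)"])
    show "continuous_on (sphere 0 1) (\<lambda>z. \<i> * cnj (c z))"
      unfolding c_def by (intro continuous_intros)
    show "Re (a * (z * (\<i> * cnj (c z))) + b * (z * cnj (\<i> * cnj (c z)))) = 0" for z
      by (simp add: c_def algebra_simps)
  qed (use nz in auto)
next
  case True
  have "\<exists>k. k \<noteq> 0 \<and> a * k + b * cnj k = 0"
  proof (cases "a = 0")
    case True
    then show ?thesis
      using \<open>norm a = norm b\<close> by (auto intro: exI[of _ 1])
  next
    case False
    \<comment> \<open>Such a \<open>k\<close> has norm 1, so \<open>cnj k\<close> is its inverse and
      the equation reduces to \<open>a * k\<^sup>2 + b = 0\<close>.\<close>
    define k where "k = csqrt (- b / a)"
    have k2: "k * k = - b / a"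
      by (metis k_def power2_csqrt power2_eq_square)
    then have "norm k * norm k = 1"
      using True False by (metis norm_mult norm_divide norm_minus_cancel divide_self norm_eq_zero)
    then have "norm k = 1"
      by (metis abs_norm_cancel abs_square_eq_1 power2_eq_square)
    then have "k * cnj k = 1"
      by (simp add: complex_norm_square[symmetric])
    then have "a * k + b * cnj k = cnj k * (a * (k * k) + b)"
      by (simp add: algebra_simps)
    also have "\<dots> = 0"
      using False by (simp add: k2)
    finally show ?thesis
      using \<open>norm k = 1\<close> by (intro exI[of _ k]) auto
  qed
  then obtain k where k: "k \<noteq> 0" "a * k + b * cnj k = 0" by blast
  have "a * (z * k) + b * (z * cnj k) = z * (a * k + b * cnj k)" for z
    by (simp add: algebra_simps)
  then have *: "a * (z * k) + b * (z * cnj k) = 0" for z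
    using k(2) by simp
  show ?thesis
    by (rule that[of "\<lambda>_. k"]) (use k(1) * in auto)
qed

text \<open>A nullhomotopy yields a continuous real \<open>g\<close> with
  \<open>z\<^sup>2 = exp (\<i> * g z)\<close>. Halving \<open>g\<close> gives a logarithm of
  \<open>z\<close> up to a constant factor, so the identity would be nullhomotopic and the circle
  contractible.\<close>

lemma square_circle_not_nullhomotopic:
  "\<not> homotopic_with_canon (\<lambda>_. True) (sphere 0 1) (sphere 0 1) (\<lambda>z::complex. z\<^sup>2) (\<lambda>_. c)"
proof
  assume "homotopic_with_canon (\<lambda>_. True) (sphere 0 1) (sphere 0 1) (\<lambda>z::complex. z\<^sup>2) (\<lambda>_. c)"
  then obtain g where g: "continuous_on (sphere (0::complex) 1) g"
    "\<And>z. z \<in> sphere 0 1 \<Longrightarrow> z\<^sup>2 = exp (\<i> * of_real (g z))"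
    using inessential_eq_continuous_logarithm_circle[of "sphere 0 1" "\<lambda>z::complex. z\<^sup>2"] by blast
  \<comment> \<open>A ratio of two square roots of \<open>z\<^sup>2\<close>: a sign, hence constant
    on the connected circle.\<close>
  define q where "q z = exp (\<i> * of_real (g z / 2)) / z" for z
  have q: "q z = 1 \<or> q z = -1" if "z \<in> sphere 0 1" for z
  proof -
    have "(exp (\<i> * of_real (g z / 2)))\<^sup>2 = exp (\<i> * of_real (g z))"
      by (simp add: exp_double[symmetric])
    then have "(q z)\<^sup>2 = 1"
      using g(2)[OF that] that by (auto simp: q_def power_divide)
    then show ?thesis
      by (simp add: power2_eq_1_iff)
  qed
  have "q constant_on sphere 0 1"
  proof (rule continuous_finite_range_constant)
    show "connected (sphere (0::complex) 1)"
      by (simp add: connected_sphere)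
    show "continuous_on (sphere 0 1) q"
      unfolding q_def by (intro continuous_intros g) auto
    have "q ` sphere 0 1 \<subseteq> {1, -1}"
      using q by blast
    then show "finite (q ` sphere 0 1)"
      by (rule finite_subset) simp
  qed
  then obtain d where d: "\<And>z. z \<in> sphere 0 1 \<Longrightarrow> q z = d"
    by (auto simp: constant_on_def)
  \<comment> \<open>Evaluating \<open>q\<close> at 1 exhibits the constant sign as
    \<open>exp (\<i> * t)\<close>, which is absorbed into the logarithm.\<close>
  define t where "t = g 1 / 2"
  have t: "d = exp (\<i> * of_real t)"
    using d[of 1] by (simp add: q_def t_def)
  have "z = exp (\<i> * of_real (g z / 2 - t))" if "z \<in> sphere 0 1" for z
  proof -
    have "z \<noteq> 0"
      using that by auto
    have "exp (\<i> * of_real (g z / 2)) = exp (\<i> * of_real t) * z"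
      using d[OF that] \<open>z \<noteq> 0\<close> by (simp add: q_def t divide_eq_eq)
    then show ?thesis
      by (simp add: right_diff_distrib exp_diff)
  qed
  then have "\<exists>a. homotopic_with_canon (\<lambda>_. True) (sphere 0 1) (sphere 0 1) (\<lambda>z::complex. z) (\<lambda>_. a)"
    unfolding inessential_eq_continuous_logarithm_circle
    by (intro exI[of _ "\<lambda>z. g z / 2 - t"]) (auto intro!: continuous_intros g(1))
  then have "contractible (sphere (0::complex) 1)"
    by (auto simp: contractible_def id_def)
  then show False
    by (simp add: contractible_sphere)
qed

section \<open>The torus and its hyperplane sections\<close>

lemma span_singleton_eqE:
  fixes v w :: "'a::real_vector"
  assumes "span {v} = span {w}" "v \<noteq> 0"
  obtains c where "c \<noteq> 0" "w = c *\<^sub>R v"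
proof -
  have "w \<in> span {v}"
    using assms(1) by (simp add: span_base)
  then obtain c where c: "w = c *\<^sub>R v"
    by (auto simp: span_singleton)
  moreover have "c \<noteq> 0"
  proof
    assume "c = 0"
    then have "span {v} = {0}"
      using assms(1) c by simp
    then show False
      using assms(2) span_base[of v "{v}"] by simp
  qed
  ultimately show ?thesis
    using that by blast
qed

lemma span_mem_projectivization_null_perp:
  assumes form: "symmetric_bilinear_form (B :: 'a::euclidean_space \<Rightarrow> 'a \<Rightarrow> real)" and "v \<noteq> 0"
  shows "span {v} \<in> projectivization (null_vectors B (perp B s)) \<longleftrightarrow> B s v = 0 \<and> B v v = 0"
proof
  assume "span {v} \<in> projectivization (null_vectors B (perp B s))"
  then obtain w where w: "w \<noteq> 0" "B s w = 0" "B w w = 0" "span {w} = span {v}"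
    by (auto simp: projectivization_def null_vectors_def perp_def)
  then obtain c where "v = c *\<^sub>R w"
    by (metis span_singleton_eqE)
  then show "B s v = 0 \<and> B v v = 0"
    using w form_right_simps[OF form] form_left_simps[OF form] by simp
next
  assume "B s v = 0 \<and> B v v = 0"
  then show "span {v} \<in> projectivization (null_vectors B (perp B s))"
    using \<open>v \<noteq> 0\<close> by (auto simp: projectivization_def null_vectors_def perp_def)
qed

text \<open>The punctured null cone of \<open>perp B s\<close> is the full preimage of
  \<open>T\<close>, and it is closed in the punctured space; a quotient map restricts to such a
  preimage. Continuity of a map on the torus can thus be checked on vectors.\<close>

lemma quotient_map_null_perp:
  fixes B :: "'a::euclidean_space \<Rightarrow> 'a \<Rightarrow> real" and s :: 'a
  assumes form: "symmetric_bilinear_form B"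
  defines "T \<equiv> projectivization (null_vectors B (perp B s))"
  shows "quotient_map (top_of_set {v. v \<noteq> 0 \<and> B s v = 0 \<and> B v v = 0})
           (subtopology projective_topology T) (\<lambda>v. span {v})"
proof -
  let ?C = "{v. v \<noteq> 0 \<and> B s v = 0 \<and> B v v = 0}"
  have C: "{v \<in> topspace (top_of_set (- {0})). span {v} \<in> T} = ?C"
    using span_mem_projectivization_null_perp[OF form] by (auto simp: T_def)
  interpret bounded_bilinear B
    using form by (simp add: symmetric_bilinear_form_def bilinear_conv_bounded_bilinear)
  have "closed {v. B s v = 0 \<and> B v v = 0}"
    by (intro closed_Collect_conj closed_Collect_eq continuous_on continuous_intros)
  then have "closedin (top_of_set (- {0})) (- {0} \<inter> {v. B s v = 0 \<and> B v v = 0})"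
    by (rule closedin_closed_Int)
  also have "- {0} \<inter> {v. B s v = 0 \<and> B v v = 0} = ?C"
    by auto
  finally have "closedin (top_of_set (- {0})) {v \<in> topspace (top_of_set (- {0})). span {v} \<in> T}"
    unfolding C .
  moreover have "T \<subseteq> topspace projective_topology"
    by (auto simp: T_def topspace_projective_topology projectivization_def)
  ultimately have "closedin projective_topology T"
    using quotient_map_projective_topology[unfolded quotient_map_closedin] by blast
  then have "quotient_map (subtopology (top_of_set (- {0})) ?C)
      (subtopology projective_topology T) (\<lambda>v. span {v})"
    by (intro quotient_map_restriction[OF quotient_map_projective_topology C]) blast
  moreover have "- {0} \<inter> ?C = ?C"
    by auto
  ultimately show ?thesis
    by (simp add: subtopology_subtopology)
qed

text \<open>The two tori enter asymmetrically: \<open>s\<close> provides the ambient torus,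
  \<open>r\<close> only a linear equation on it. Exchanging them yields the other half of the
  theorem.\<close>

lemma null_perp_section_noncontractible:
  fixes B :: "'a::euclidean_space \<Rightarrow> 'a \<Rightarrow> real" and r s :: 'a
  assumes form: "symmetric_bilinear_form B" and sig: "has_signature B 3 2"
    and dim: "DIM('a) = 5" and s: "B s s > 0"
  defines "T \<equiv> projectivization (null_vectors B (perp B s))"
  defines "A \<equiv> T \<inter> projectivization (null_vectors B (perp B r))"
  shows "noncontractible_in (subtopology (einstein_topology B) T) A"
proof -
  obtain \<Phi> :: "complex \<times> complex \<Rightarrow> 'a" and U W :: "'a \<Rightarrow> complex"
    where lin: "linear \<Phi>" "linear U" "linear W" and perp: "\<And>p. \<Phi> p \<in> perp B s"
      and UW: "\<And>u w. U (\<Phi> (u, w)) = u" "\<And>u w. W (\<Phi> (u, w)) = w"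
      and \<Phi>UW: "\<And>v. v \<in> perp B s \<Longrightarrow> \<Phi> (U v, W v) = v"
      and B\<Phi>: "\<And>u w. B (\<Phi> (u, w)) (\<Phi> (u, w)) = (norm u)\<^sup>2 - (norm w)\<^sup>2"
    using perp_complex_coordinates[OF form sig dim s] by blast
  define X where "X = subtopology projective_topology T"
  define circle where "circle = top_of_set (sphere (0::complex) 1)"
  have "T \<subseteq> einstein_universe B"
    using einstein_torus_subset s by (auto simp: T_def einstein_torus_def)
  then have X: "subtopology (einstein_topology B) T = X"
    by (simp add: X_def einstein_topology_def subtopology_subtopology inf_absorb2)

  let ?C = "{v. v \<noteq> 0 \<and> B s v = 0 \<and> B v v = 0}"
  \<comment> \<open>On the null cone \<open>U v\<close> and \<open>W v\<close> have equal norm, so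
    if one vanishes both do, and \<open>v\<close> is zero.\<close>
  have nz: "U v * W v \<noteq> 0" if "v \<in> ?C" for v
  proof
    assume "U v * W v = 0"
    have v: "\<Phi> (U v, W v) = v"
      using that \<Phi>UW by (simp add: perp_def)
    then have "(norm (U v))\<^sup>2 - (norm (W v))\<^sup>2 = 0"
      using that B\<Phi>[of "U v" "W v"] by simp
    then have "U v = 0" "W v = 0"
      using \<open>U v * W v = 0\<close> by auto
    then show False
      using v that linear_0[OF lin(1)] by (simp add: zero_prod_def)
  qed
  \<comment> \<open>Replacing \<open>v\<close> by \<open>c *\<^sub>R v\<close> multiplies the
    product by \<open>c\<^sup>2 > 0\<close>, so its direction descends to lines; \<open>g\<close>
    evaluates it at a chosen representative.\<close>
  define G where "G v = sgn (U v * W v)" for v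
  define g where "g L = G (SOME v. v \<noteq> 0 \<and> span {v} = L)" for L
  have g: "g (span {v}) = G v" if "v \<noteq> 0" for v
  proof -
    define w where "w = (SOME w. w \<noteq> 0 \<and> span {w} = span {v})"
    have "w \<noteq> 0 \<and> span {w} = span {v}"
      unfolding w_def by (rule someI[of _ v]) (simp add: that)
    then obtain c where "c \<noteq> 0" "w = c *\<^sub>R v"
      using span_singleton_eqE[of v w] \<open>v \<noteq> 0\<close> by metis
    then have "G w = G v"
      using lin by (simp add: G_def linear_scale sgn_scaleR sgn_mult)
    then show ?thesis
      by (simp add: g_def w_def)
  qed
  have "continuous_on ?C U" "continuous_on ?C W"
    using lin by (simp_all add: linear_continuous_on linear_conv_bounded_linear)
  then have "continuous_on ?C G"
    unfolding G_def using nz by (intro continuous_on_sgn continuous_on_mult) blast+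
  then have "continuous_map (top_of_set ?C) circle G"
    using nz by (auto simp: circle_def G_def norm_sgn)
  then have "continuous_map (top_of_set ?C) circle (g \<circ> (\<lambda>v. span {v}))"
    by (rule continuous_map_eq) (simp add: g)
  then have contg: "continuous_map X circle g"
    unfolding X_def T_def
    by (rule continuous_compose_quotient_map[OF quotient_map_null_perp[OF form]])

  have "linear (\<lambda>p. B r (\<Phi> p))"
    using linear_compose[OF lin(1) linear_form_right[OF form]] by (simp add: o_def)
  then obtain a b where ab: "\<And>u w. B r (\<Phi> (u, w)) = Re (a * u + b * w)"
    by (metis real_linear_complex_pair)
  obtain k where k: "continuous_on (sphere 0 1) k" "\<And>z. z \<in> sphere 0 1 \<Longrightarrow> k z \<noteq> 0"
    "\<And>z. z \<in> sphere 0 1 \<Longrightarrow> Re (a * (z * k z) + b * (z * cnj (k z))) = 0"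
    using hyperplane_circle_solution[of a b] by metis
  \<comment> \<open>The two coordinates have equal norm, which makes \<open>p z\<close> null, and
    their product is the positive number \<open>(norm (k z))\<^sup>2\<close> times
    \<open>z\<^sup>2\<close>.\<close>
  define p where "p z = \<Phi> (z * k z, z * cnj (k z))" for z
  have G_p: "G (p z) = z\<^sup>2" and p_nz: "p z \<noteq> 0" if "z \<in> sphere 0 1" for z
  proof -
    have "norm z = 1"
      using that by simp
    have "U (p z) * W (p z) = (k z * cnj (k z)) * z\<^sup>2"
      by (simp add: p_def UW power2_eq_square)
    then have "U (p z) * W (p z) = (norm (k z))\<^sup>2 *\<^sub>R z\<^sup>2"
      by (simp only: complex_norm_square[symmetric] scaleR_conv_of_real)
    then show "G (p z) = z\<^sup>2"
      using k(2)[OF that] \<open>norm z = 1\<close> by (simp add: G_def sgn_scaleR sgn_div_norm norm_power)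
    have "U (p z) \<noteq> 0"
      using k(2)[OF that] \<open>norm z = 1\<close> by (auto simp: p_def UW)
    then show "p z \<noteq> 0"
      using linear_0[OF lin(2)] by auto
  qed
  have p_A: "span {p z} \<in> A" if "z \<in> sphere 0 1" for z
  proof -
    have "B (p z) (p z) = 0"
      by (simp add: p_def B\<Phi> norm_mult)
    moreover have "B s (p z) = 0"
      using perp by (simp add: p_def perp_def)
    moreover have "B r (p z) = 0"
      using k(3)[OF that] by (simp add: p_def ab)
    ultimately show ?thesis
      using p_nz[OF that] by (simp add: A_def T_def span_mem_projectivization_null_perp[OF form])
  qed
  have "continuous_on (sphere 0 1) p"
    unfolding p_def using lin(1) k(1)
    by (intro linear_continuous_on_compose[of _ _ \<Phi>] continuous_intros) auto
  then have "continuous_map circle (top_of_set (- {0})) p"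
    using p_nz by (auto simp: circle_def)
  then have "continuous_map circle projective_topology (\<lambda>z. span {p z})"
    using continuous_map_compose[OF _ quotient_imp_continuous_map[OF quotient_map_projective_topology]]
    by (fastforce simp: o_def)
  then have contp: "continuous_map circle (subtopology X A) (\<lambda>z. span {p z})"
    using p_A by (auto simp: X_def subtopology_subtopology continuous_map_in_subtopology circle_def A_def)

  have "A \<subseteq> topspace X"
    by (auto simp: A_def T_def X_def topspace_projective_topology projectivization_def)
  moreover have False if "homotopic_with (\<lambda>_. True) (subtopology X A) X (\<lambda>x. x) (\<lambda>_. c)" for c
  proof -
    \<comment> \<open>Precomposing with the circle in \<open>A\<close> and postcomposing with
      \<open>g\<close> turns a contraction of \<open>A\<close> in the torus into a nullhomotopy of
      the squaring map.\<close>
    have "homotopic_with (\<lambda>_. True) circle X ((\<lambda>x. x) \<circ> (\<lambda>z. span {p z})) ((\<lambda>_. c) \<circ> (\<lambda>z. span {p z}))"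
      using that contp by (rule homotopic_with_compose_continuous_map_right) simp
    then have "homotopic_with (\<lambda>_. True) circle circle
        (g \<circ> ((\<lambda>x. x) \<circ> (\<lambda>z. span {p z}))) (g \<circ> ((\<lambda>_. c) \<circ> (\<lambda>z. span {p z})))"
      using contg by (rule homotopic_with_compose_continuous_map_left) simp
    then have "homotopic_with (\<lambda>_. True) circle circle (\<lambda>z. z\<^sup>2) (\<lambda>_. g c)"
      by (rule homotopic_with_eq) (simp_all add: circle_def g G_p p_nz)
    then show False
      using square_circle_not_nullhomotopic by (simp add: circle_def)
  qed
  ultimately show ?thesis
    unfolding noncontractible_in_def X by blast
qed

theorem corollary2:
  fixes B :: "'a::euclidean_space \<Rightarrow> 'a \<Rightarrow> real"
    and T1 T2 :: "'a set set"
  assumes "DIM('a) = 5"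
    and "symmetric_bilinear_form B"
    and "has_signature B 3 2"
    and "einstein_torus B T1"
    and "einstein_torus B T2"
  shows "noncontractible_in (subtopology (einstein_topology B) T1) (T1 \<inter> T2) \<and>
         noncontractible_in (subtopology (einstein_topology B) T2) (T1 \<inter> T2)"
proof -
  obtain s1 s2 where "B s1 s1 > 0" "T1 = projectivization (null_vectors B (perp B s1))"
    "B s2 s2 > 0" "T2 = projectivization (null_vectors B (perp B s2))"
    using assms(4,5) by (auto simp: einstein_torus_def)
  then show ?thesis
    using null_perp_section_noncontractible[OF assms(2,3,1)] by (metis Int_commute)
qed

end
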